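(* Let $A\subset\mathbb{Z}_+$ and $\alpha\in\mathbb{R}$. Let $\mathbf{E}$ be a URI-set, and for each $n\ge1$ let the elements of $\mathbf{E}_n:=\mathbf{E}\cap\{1,\ldots,n\}$ be listed in decreasing order as $$\mathbf{E}_n=\bigl\{Y_1^{(n)}>Y_2^{(n)}>\cdots>Y_{|\mathbf{E}_n|}^{(n)}=1\bigr\}.$$ Then $A$ has $H^\infty$-density $\alpha$ if and only if $$\lim_{k\to\infty}\liminf_{n\to\infty}\mathbb{P}\bigl(Y_k^{(n)}\in A\bigr)=\lim_{k\to\infty}\limsup_{n\to\infty}\mathbb{P}\bigl(Y_k^{(n)}\in A\bigr)=\alpha.$$
   Context: $\mathbb{Z}_+$ denotes the set of positive integers. A URI-set is a random set $\mathbf{E}$ of positive integers such that each integer $n\ge1$ belongs to $\mathbf{E}$ with probability $1/n$, the events $(n\in\mathbf{E})$, $n\ge1$, being independent. The event $(Y_k^{(n)}\in A)$ is understood as $(|\mathbf{E}_n|\ge k \text{ and } Y_k^{(n)}\in A)$. For $A\subset\mathbb{Z}_+$, define inductively, for $n\ge1$, $P_n^0:=\mathbf{1}_A(n)$ (the indicator function of $A$) and $P_n^{k+1}:=\frac1n\sum_{j=1}^nP_j^k$ for $k\ge0$. The set $A$ has $H^\infty$-density $\alpha$ if $\lim_{k\to\infty}\limsup_{n\to\infty}P_n^k=\lim_{k\to\infty}\liminf_{n\to\infty}P_n^k=\alpha$. *)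

theory Defs
  imports "HOL-Probability.Probability"
begin

context prob_space
begin

(* Measurability of the events (n \<in> E) is part of indep_events. *)
definition URI_set :: "('a \<Rightarrow> nat set) \<Rightarrow> bool" where
  "URI_set E \<longleftrightarrow>
     (\<forall>\<omega>\<in>space M. E \<omega> \<subseteq> {1..}) \<and>
     (\<forall>n\<ge>1. prob {\<omega> \<in> space M. n \<in> E \<omega>} = 1 / real n) \<and>
     indep_events (\<lambda>n. {\<omega> \<in> space M. n \<in> E \<omega>}) {1..}"

end

(* Y S n k is the k-th element of S \<inter> {1..n} in decreasing order, counting from k = 1.
   It is meaningful only for 1 \<le> k \<le> card (S \<inter> {1..n}). *)
definition Y :: "nat set \<Rightarrow> nat \<Rightarrow> nat \<Rightarrow> nat" where
  "Y S n k = rev (sorted_list_of_set (S \<inter> {1..n})) ! (k - 1)"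

context prob_space
begin

definition prob_Y_in :: "('a \<Rightarrow> nat set) \<Rightarrow> nat set \<Rightarrow> nat \<Rightarrow> nat \<Rightarrow> real" where
  "prob_Y_in E A k n =
     prob {\<omega> \<in> space M. k \<le> card (E \<omega> \<inter> {1..n}) \<and> Y (E \<omega>) n k \<in> A}"

end

(* iter_mean A k n is P_n^k; the value at n = 0 is irrelevant, the sums starting at 1. *)
primrec iter_mean :: "nat set \<Rightarrow> nat \<Rightarrow> nat \<Rightarrow> real" where
  "iter_mean A 0 n = indicator A n"
| "iter_mean A (Suc k) n = (\<Sum>j=1..n. iter_mean A k j) / real n"

(* limsup and liminf need a complete lattice, hence the coercion to ereal. *)
definition has_H_infinity_density :: "nat set \<Rightarrow> real \<Rightarrow> bool" where
  "has_H_infinity_density A \<alpha> \<longleftrightarrow>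
     ((\<lambda>k. limsup (\<lambda>n. ereal (iter_mean A k n))) \<longlonglongrightarrow> ereal \<alpha>) \<and>
     ((\<lambda>k. liminf (\<lambda>n. ereal (iter_mean A k n))) \<longlonglongrightarrow> ereal \<alpha>)"

end

theory Submission
  imports Defs
begin

text \<open>
  Both sides of the equivalence are governed by almost the same recursion. Write \<open>Q k n\<close> for the
  probability that the \<open>k\<close>-th largest element of \<open>E \<inter> {1..n}\<close> exists and lies in \<open>A\<close>. The event
  \<open>n \<in> E\<close> has probability \<open>1/n\<close> and is independent of \<open>E \<inter> {1..n-1}\<close>. If it occurs, the largest
  element is \<open>n\<close> and the \<open>(k+1)\<close>-st largest is the \<open>k\<close>-th largest of \<open>E \<inter> {1..n-1}\<close>; if it does
  not occur, nothing changes from \<open>n - 1\<close> to \<open>n\<close>. Hence, for \<open>k \<ge> 1\<close>,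
  \<open>n * Q (k+1) n = Q k (n-1) + (n-1) * Q (k+1) (n-1)\<close>, which telescopes to
  \<open>Q (k+1) n = (\<Sum>j<n. Q k j) / n\<close>, and likewise \<open>Q 1\<close> is exactly the first iterated mean.

  The iterated means satisfy the same recursion with \<open>j \<le> n\<close> in place of \<open>j < n\<close>. The
  discrepancy is a single term divided by \<open>n\<close>, so by induction on \<open>k\<close> and Cesaro averaging the
  difference between \<open>Q k n\<close> and the \<open>k\<close>-th iterated mean tends to \<open>0\<close> as \<open>n \<rightarrow> \<infinity>\<close>
  (lemma \<open>iter_mean_minus_prob_Y_in\<close>). For each \<open>k \<ge> 1\<close> the two sequences in \<open>n\<close> therefore have
  the same upper limit and the same lower limit, and the limits over \<open>k\<close> agree.
\<close>

lemma Cesaro_means_tendsto_0: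
  fixes d :: "nat \<Rightarrow> real"
  assumes "d \<longlonglongrightarrow> 0"
  shows "(\<lambda>n. (\<Sum>j<n. d j) / real n) \<longlonglongrightarrow> 0"
proof (rule LIMSEQ_I)
  fix e :: real assume "e > 0"
  then obtain N where N: "\<And>j. j \<ge> N \<Longrightarrow> \<bar>d j\<bar> < e / 2"
    using LIMSEQ_D[OF assms, of "e / 2"] by auto
  define C where "C = (\<Sum>j<N. \<bar>d j\<bar>)"
  have "(\<lambda>n. C / real n) \<longlonglongrightarrow> 0"
    by (rule lim_const_over_n)
  then obtain K where K: "\<And>n. n \<ge> K \<Longrightarrow> \<bar>C / real n\<bar> < e / 2"
    using LIMSEQ_D[of "\<lambda>n. C / real n" 0 "e / 2"] \<open>e > 0\<close> by auto
  have "norm ((\<Sum>j<n. d j) / real n - 0) < e" if n: "n \<ge> max (Suc N) K" for n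
  proof -
    have "\<bar>\<Sum>j<n. d j\<bar> \<le> (\<Sum>j<n. \<bar>d j\<bar>)"
      by (rule sum_abs)
    also have "\<dots> = C + (\<Sum>j=N..<n. \<bar>d j\<bar>)"
      unfolding C_def lessThan_atLeast0 using n by (simp add: sum.atLeastLessThan_concat)
    also have "\<dots> \<le> C + (\<Sum>j=N..<n. e / 2)"
      using N by (intro add_left_mono sum_mono) (simp add: less_imp_le)
    also have "\<dots> \<le> C + real n * (e / 2)"
      using \<open>e > 0\<close> by (simp add: mult_right_mono)
    finally have "\<bar>\<Sum>j<n. d j\<bar> / real n \<le> (C + real n * (e / 2)) / real n"
      by (rule divide_right_mono) simp
    also have "\<dots> = C / real n + e / 2"
      using n by (simp add: add_divide_distrib)
    also have "\<dots> < e"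
      using K[of n] n abs_ge_self[of "C / real n"] by linarith
    finally show ?thesis
      by simp
  qed
  then show "\<exists>no. \<forall>n\<ge>no. norm ((\<Sum>j<n. d j) / real n - 0) < e"
    by blast
qed

lemma limsup_liminf_eq_of_diff_tendsto_0:
  fixes f g :: "nat \<Rightarrow> real"
  assumes "(\<lambda>n. f n - g n) \<longlonglongrightarrow> 0"
  shows "limsup (\<lambda>n. ereal (f n)) = limsup (\<lambda>n. ereal (g n))"
    and "liminf (\<lambda>n. ereal (f n)) = liminf (\<lambda>n. ereal (g n))"
proof -
  have lim: "(\<lambda>n. ereal (f n - g n)) \<longlonglongrightarrow> 0"
    using assms by (simp add: zero_ereal_def)
  have split: "(\<lambda>n. ereal (f n)) = (\<lambda>n. ereal (f n - g n) + ereal (g n))"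
    by simp
  show "limsup (\<lambda>n. ereal (f n)) = limsup (\<lambda>n. ereal (g n))"
    unfolding split using ereal_limsup_lim_add[OF lim, of "\<lambda>n. ereal (g n)"] by simp
  show "liminf (\<lambda>n. ereal (f n)) = liminf (\<lambda>n. ereal (g n))"
    unfolding split using ereal_liminf_lim_add[OF lim, of "\<lambda>n. ereal (g n)"] by simp
qed

lemma iter_mean_in_unit_interval: "iter_mean A k n \<in> {0..1}"
proof (induction k arbitrary: n)
  case 0
  then show ?case by (simp add: indicator_def)
next
  case (Suc k)
  have "(\<Sum>j=1..n. iter_mean A k j) \<le> real n"
    using sum_bounded_above[of "{1..n}" "iter_mean A k" 1] Suc.IH by simp
  moreover have "(\<Sum>j=1..n. iter_mean A k j) \<ge> 0"
    using Suc.IH by (intro sum_nonneg) simp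
  ultimately show ?case
    by (auto simp: divide_le_eq_1)
qed

text \<open>The event of interest depends on \<open>S\<close> only through the finite set \<open>T = S \<inter> {1..n}\<close>, and as a
  predicate of \<open>T\<close> it has a simple recursion under insertion of a new maximum.\<close>

definition kth_largest_in :: "nat set \<Rightarrow> nat \<Rightarrow> nat set \<Rightarrow> bool" where
  "kth_largest_in A k T \<longleftrightarrow> k \<le> card T \<and> rev (sorted_list_of_set T) ! (k - 1) \<in> A"

lemma not_kth_largest_in_empty: "\<not> kth_largest_in A (Suc k) {}"
  by (simp add: kth_largest_in_def)

lemma kth_largest_in_insert_max:
  assumes "finite T" and "\<And>x. x \<in> T \<Longrightarrow> x < m"
  shows "kth_largest_in A (Suc 0) (insert m T) \<longleftrightarrow> m \<in> A"
    and "kth_largest_in A (Suc (Suc k)) (insert m T) \<longleftrightarrow> kth_largest_in A (Suc k) T"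
proof -
  have "m \<notin> T"
    using assms(2) by blast
  moreover have "sorted_list_of_set (insert m T) = sorted_list_of_set T @ [m]"
    using assms \<open>m \<notin> T\<close> by (simp add: sorted_list_of_set_insert sorted_insort_is_snoc less_imp_le)
  ultimately show "kth_largest_in A (Suc 0) (insert m T) \<longleftrightarrow> m \<in> A"
    and "kth_largest_in A (Suc (Suc k)) (insert m T) \<longleftrightarrow> kth_largest_in A (Suc k) T"
    using assms(1) by (simp_all add: kth_largest_in_def)
qed

lemma Int_atLeastAtMost_Suc:
  fixes S :: "nat set"
  shows "S \<inter> {1..Suc n} = (if Suc n \<in> S then insert (Suc n) (S \<inter> {1..n}) else S \<inter> {1..n})"
  by (auto simp: le_Suc_eq)

context prob_space
begin

lemma prob_Y_in_eq:
  "prob_Y_in E A k n = prob {\<omega> \<in> space M. kth_largest_in A k (E \<omega> \<inter> {1..n})}"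
  by (simp add: prob_Y_in_def Y_def kth_largest_in_def)

text \<open>A property of \<open>E \<inter> {1..n}\<close> is a finite Boolean combination of the events \<open>i \<in> E\<close>; peeling off
  the largest index leaves a property of \<open>E \<inter> {1..n-1}\<close> in each of the two cases.\<close>

lemma initial_part_in_sigma_sets:
  fixes E :: "'a \<Rightarrow> nat set"
  shows "{\<omega> \<in> space M. P (E \<omega> \<inter> {1..n})}
     \<in> sigma_sets (space M) (\<Union>i\<in>{1..n}. {{\<omega> \<in> space M. i \<in> E \<omega>}})"
proof (induction n arbitrary: P)
  case 0
  interpret S: sigma_algebra "space M" "sigma_sets (space M) {} :: 'a set set"
    by (rule sigma_algebra_sigma_sets) simp
  show ?case
    by (cases "P {}") auto
next
  case (Suc n)
  let ?G = "\<lambda>n. (\<Union>i\<in>{1..n}. {{\<omega> \<in> space M. i \<in> E \<omega>}})"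
  let ?N = "{\<omega> \<in> space M. Suc n \<in> E \<omega>}"
  interpret S: sigma_algebra "space M" "sigma_sets (space M) (?G (Suc n))"
    by (rule sigma_algebra_sigma_sets) auto
  have "sigma_sets (space M) (?G n) \<subseteq> sigma_sets (space M) (?G (Suc n))"
    by (rule sigma_sets_subseteq) force
  then have IH: "{\<omega> \<in> space M. Q (E \<omega> \<inter> {1..n})} \<in> sigma_sets (space M) (?G (Suc n))" for Q
    using Suc.IH[of Q] by blast
  have N: "?N \<in> sigma_sets (space M) (?G (Suc n))"
    by (rule sigma_sets.Basic) auto
  have "{\<omega> \<in> space M. P (E \<omega> \<inter> {1..Suc n})} =
      (?N \<inter> {\<omega> \<in> space M. P (insert (Suc n) (E \<omega> \<inter> {1..n}))})
      \<union> ({\<omega> \<in> space M. P (E \<omega> \<inter> {1..n})} - ?N)"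
    unfolding Int_atLeastAtMost_Suc by auto
  also have "\<dots> \<in> sigma_sets (space M) (?G (Suc n))"
    using IH[of P] IH[of "\<lambda>T. P (insert (Suc n) T)"] N by (intro S.Un S.Int S.Diff)
  finally show ?case .
qed

lemma URI_set_initial_part_event:
  assumes "URI_set E"
  shows "{\<omega> \<in> space M. P (E \<omega> \<inter> {1..n})} \<in> events"
proof -
  have "(\<Union>i\<in>{1..n}. {{\<omega> \<in> space M. i \<in> E \<omega>}}) \<subseteq> events"
    using assms unfolding URI_set_def indep_events_def by force
  from sets.sigma_sets_subset[OF this] show ?thesis
    using initial_part_in_sigma_sets[of P E n] by blast
qed

text \<open>Independence survives grouping the events into disjoint blocks: those with index at most \<open>n\<close> on one side, the one
  with index \<open>n + 1\<close> on the other.\<close>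

lemma URI_set_indep_next:
  assumes "URI_set E"
  shows "prob ({\<omega> \<in> space M. Suc n \<in> E \<omega>} \<inter> {\<omega> \<in> space M. P (E \<omega> \<inter> {1..n})})
    = prob {\<omega> \<in> space M. P (E \<omega> \<inter> {1..n})} / real (Suc n)"
proof -
  let ?F = "\<lambda>i. {{\<omega> \<in> space M. i \<in> E \<omega>}}"
  let ?I = "\<lambda>b. if b then {Suc n} else {1..n}"
  let ?N = "{\<omega> \<in> space M. Suc n \<in> E \<omega>}" and ?P = "{\<omega> \<in> space M. P (E \<omega> \<inter> {1..n})}"
  have "indep_sets ?F {1..}"
    using assms by (simp add: URI_set_def indep_events_def_alt)
  then have "indep_sets ?F (\<Union>b\<in>UNIV. ?I b)"
    by (rule indep_sets_mono_index[rotated]) auto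
  then have indep: "indep_sets (\<lambda>b. sigma_sets (space M) (\<Union>i\<in>?I b. ?F i)) UNIV"
    by (rule indep_sets_collect_sigma) (auto simp: Int_stable_def disjoint_family_on_def)
  have "prob (\<Inter>b\<in>UNIV. if b then ?N else ?P) = (\<Prod>b\<in>UNIV. prob (if b then ?N else ?P))"
    by (rule indep_setsD[OF indep]) (auto intro: initial_part_in_sigma_sets sigma_sets.Basic simp del: One_nat_def)
  then have "prob (?N \<inter> ?P) = prob ?N * prob ?P"
    by (simp add: UNIV_bool Int_commute mult.commute)
  moreover have "prob ?N = 1 / real (Suc n)"
    using assms by (simp add: URI_set_def)
  ultimately show ?thesis
    by simp
qed

lemma URI_set_prob_split:
  assumes "URI_set E"
  shows "real (Suc n) * prob {\<omega> \<in> space M. P (E \<omega> \<inter> {1..Suc n})} =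
    prob {\<omega> \<in> space M. P (insert (Suc n) (E \<omega> \<inter> {1..n}))}
    + real n * prob {\<omega> \<in> space M. P (E \<omega> \<inter> {1..n})}"
proof -
  let ?N = "{\<omega> \<in> space M. Suc n \<in> E \<omega>}"
  let ?P = "{\<omega> \<in> space M. P (E \<omega> \<inter> {1..n})}"
  let ?Q = "{\<omega> \<in> space M. P (insert (Suc n) (E \<omega> \<inter> {1..n}))}"
  have ev: "?N \<in> events" "?P \<in> events" "?Q \<in> events"
    using assms URI_set_initial_part_event[OF assms, of P]
      URI_set_initial_part_event[OF assms, of "\<lambda>T. P (insert (Suc n) T)"]
    by (auto simp: URI_set_def indep_events_def)
  have "{\<omega> \<in> space M. P (E \<omega> \<inter> {1..Suc n})} = (?N \<inter> ?Q) \<union> (?P - ?N)"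
    unfolding Int_atLeastAtMost_Suc by auto
  then have "prob {\<omega> \<in> space M. P (E \<omega> \<inter> {1..Suc n})} = prob (?N \<inter> ?Q) + prob (?P - ?N)"
    using ev by (simp add: finite_measure_Union Int_Diff_disjoint) (subst finite_measure_Union; auto)
  also have "prob (?P - ?N) = prob ?P - prob (?N \<inter> ?P)"
    using ev by (simp add: finite_measure_Diff' Int_commute)
  also have "prob (?N \<inter> ?P) = prob ?P / real (Suc n)"
    by (rule URI_set_indep_next[OF assms])
  also have "prob (?N \<inter> ?Q) = prob ?Q / real (Suc n)"
    by (rule URI_set_indep_next[OF assms, of n "\<lambda>T. P (insert (Suc n) T)"])
  finally show ?thesis
    by (simp add: field_simps del: of_nat_Suc) (simp add: algebra_simps)
qed

lemma prob_Y_in_1_eq_iter_mean: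
  assumes "URI_set E"
  shows "prob_Y_in E A (Suc 0) n = iter_mean A (Suc 0) n"
proof -
  have "real n * prob_Y_in E A (Suc 0) n = (\<Sum>j=1..n. indicator A j)"
  proof (induction n)
    case (Suc n)
    have "kth_largest_in A (Suc 0) (insert (Suc n) (E \<omega> \<inter> {1..n})) \<longleftrightarrow> Suc n \<in> A" for \<omega>
      by (rule kth_largest_in_insert_max) auto
    then have "prob {\<omega> \<in> space M. kth_largest_in A (Suc 0) (insert (Suc n) (E \<omega> \<inter> {1..n}))}
        = indicator A (Suc n)"
      by (simp add: prob_space indicator_def)
    then show ?case
      using URI_set_prob_split[OF assms, of n "kth_largest_in A (Suc 0)"] Suc
      by (simp add: prob_Y_in_eq)
  qed simp
  then show ?thesis
    by (cases "n = 0") (simp_all add: prob_Y_in_eq not_kth_largest_in_empty field_simps)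
qed

lemma prob_Y_in_Suc_Suc:
  assumes "URI_set E"
  shows "prob_Y_in E A (Suc (Suc k)) n = (\<Sum>j<n. prob_Y_in E A (Suc k) j) / real n"
proof -
  have "real n * prob_Y_in E A (Suc (Suc k)) n = (\<Sum>j<n. prob_Y_in E A (Suc k) j)"
  proof (induction n)
    case (Suc n)
    have "kth_largest_in A (Suc (Suc k)) (insert (Suc n) (E \<omega> \<inter> {1..n}))
        \<longleftrightarrow> kth_largest_in A (Suc k) (E \<omega> \<inter> {1..n})" for \<omega>
      by (rule kth_largest_in_insert_max) auto
    then show ?case
      using URI_set_prob_split[OF assms, of n "kth_largest_in A (Suc (Suc k))"] Suc
      by (simp add: prob_Y_in_eq)
  qed simp
  then show ?thesis
    by (cases "n = 0") (simp_all add: prob_Y_in_eq not_kth_largest_in_empty field_simps)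
qed

text \<open>The two recursions differ only by the last summand, a number in \<open>{0..1}\<close> divided by \<open>n\<close>, and
  averaging preserves null sequences. The index starts at \<open>1\<close>, where the two sides coincide, since
  no \<open>0\<close>-th largest element corresponds to the indicator of \<open>A\<close>.\<close>

lemma iter_mean_minus_prob_Y_in:
  assumes "URI_set E"
  shows "(\<lambda>n. iter_mean A (Suc k) n - prob_Y_in E A (Suc k) n) \<longlonglongrightarrow> 0"
proof (induction k)
  case 0
  show ?case
    unfolding prob_Y_in_1_eq_iter_mean[OF assms] by simp
next
  case (Suc k)
  let ?p = "iter_mean A (Suc k)" and ?q = "prob_Y_in E A (Suc k)"
  \<comment> \<open>The right-hand side has the extra term \<open>?p 0\<close>, an empty sum divided by \<open>0\<close>, which is \<open>0\<close>.\<close>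
  have "(\<Sum>j=1..n. ?p j) = (\<Sum>j<n. ?p j) + ?p n" for n
    by (induction n) simp_all
  then have eq: "iter_mean A (Suc (Suc k)) n - prob_Y_in E A (Suc (Suc k)) n
      = (\<Sum>j<n. ?p j - ?q j) / real n + ?p n / real n" for n
    unfolding prob_Y_in_Suc_Suc[OF assms] iter_mean.simps(2)[of A "Suc k"]
    by (simp add: sum_subtractf diff_divide_distrib add_divide_distrib del: iter_mean.simps)
  have "(\<lambda>n. ?p n / real n) \<longlonglongrightarrow> 0"
  proof (rule tendsto_sandwich)
    show "\<forall>\<^sub>F n in sequentially. 0 \<le> ?p n / real n"
      using iter_mean_in_unit_interval[of A "Suc k"] by (auto simp del: iter_mean.simps)
    show "\<forall>\<^sub>F n in sequentially. ?p n / real n \<le> 1 / real n"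
      using iter_mean_in_unit_interval[of A "Suc k"]
      by (intro always_eventually allI divide_right_mono) (auto simp del: iter_mean.simps)
  qed (auto intro: lim_const_over_n)
  with Cesaro_means_tendsto_0[OF Suc] show ?case
    unfolding eq using tendsto_add by fastforce
qed

end

theorem proposition6p1:
  fixes M :: "'a measure" and E :: "'a \<Rightarrow> nat set" and A :: "nat set" and \<alpha> :: real
  assumes "prob_space M"
    and "prob_space.URI_set M E"
    and "A \<subseteq> {1..}"
  shows "has_H_infinity_density A \<alpha> \<longleftrightarrow>
     ((\<lambda>k. liminf (\<lambda>n. ereal (prob_space.prob_Y_in M E A k n))) \<longlonglongrightarrow> ereal \<alpha>) \<and>
     ((\<lambda>k. limsup (\<lambda>n. ereal (prob_space.prob_Y_in M E A k n))) \<longlonglongrightarrow> ereal \<alpha>)"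
proof -
  interpret prob_space M by fact
  note diff = iter_mean_minus_prob_Y_in[OF assms(2), of A]
  note eqs = limsup_liminf_eq_of_diff_tendsto_0[OF diff]
  \<comment> \<open>Shifting \<open>k\<close> by one discards the meaningless index \<open>k = 0\<close>.\<close>
  have "((\<lambda>k. limsup (\<lambda>n. ereal (iter_mean A k n))) \<longlonglongrightarrow> ereal \<alpha>) \<longleftrightarrow>
      ((\<lambda>k. limsup (\<lambda>n. ereal (prob_Y_in E A k n))) \<longlonglongrightarrow> ereal \<alpha>)"
    by (subst (1 2) filterlim_sequentially_Suc[symmetric]) (simp only: eqs(1))
  moreover have "((\<lambda>k. liminf (\<lambda>n. ereal (iter_mean A k n))) \<longlonglongrightarrow> ereal \<alpha>) \<longleftrightarrow>
      ((\<lambda>k. liminf (\<lambda>n. ereal (prob_Y_in E A k n))) \<longlonglongrightarrow> ereal \<alpha>)"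
    by (subst (1 2) filterlim_sequentially_Suc[symmetric]) (simp only: eqs(2))
  ultimately show ?thesis
    unfolding has_H_infinity_density_def by blast
qed

end
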